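(* If $t\geq 2$ is an integer, then for every positive integer $n$ we have $$P_{b(t)}(a^{-}(t,0);n)=\sum_{r=1}^{t-1}(-1)^{r+1}\left( P_{b(t)}(a^{+}(t,r);n-\omega^{-}(r))+P_{b(t)}(a^{-}(t,r);n-\omega^{+}(r))\right),$$ where $$a^{-}(t,r):=(2t-1)(3t-3r-2),\qquad a^{+}(t,r):=(2t-1)(3t-3r-1),\qquad b(t):=3(2t-1)^2,$$ $$\omega^{-}(r):=(3r^2-r)/2,\qquad \omega^{+}(r):=(3r^2+r)/2.$$
   Context: $P_b(a;n)$ denotes the number of partitions of $n$ into parts which are not congruent to $0,\pm a \pmod b$; equivalently $\sum_{n\ge 0}P_b(a;n)q^n=\prod_{n\ge 1,\ n\not\equiv 0,\pm a\ (\mathrm{mod}\ b)}\frac{1}{1-q^n}$. In particular $P_b(a;0)=1$ and $P_b(a;n)=0$ for $n<0$. *)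

theory Defs
  imports "HOL-Library.Multiset" "HOL-Number_Theory.Cong"
begin

text \<open>
  A partition is the multiset of its parts. The modulus, the residue and the partitioned
  number are integers, so that \<open>- a\<close> and shifted arguments such as \<open>n - \<omega>\<close> need no
  truncated subtraction; for negative \<open>n\<close> the set of partitions is empty.
\<close>

definition restricted_partitions :: "int \<Rightarrow> int \<Rightarrow> int \<Rightarrow> nat multiset set" where
  "restricted_partitions b a n =
     {M. int (sum_mset M) = n \<and>
         (\<forall>x\<in>#M. 0 < x \<and> \<not> [int x = 0] (mod b) \<and>
                 \<not> [int x = a] (mod b) \<and> \<not> [int x = - a] (mod b))}"

definition partition_count :: "int \<Rightarrow> int \<Rightarrow> int \<Rightarrow> nat" where
  "partition_count b a n = card (restricted_partitions b a n)"

definition a_minus :: "nat \<Rightarrow> nat \<Rightarrow> int" where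
  "a_minus t r = (2 * int t - 1) * (3 * int t - 3 * int r - 2)"

definition a_plus :: "nat \<Rightarrow> nat \<Rightarrow> int" where
  "a_plus t r = (2 * int t - 1) * (3 * int t - 3 * int r - 1)"

definition b_mod :: "nat \<Rightarrow> int" where
  "b_mod t = 3 * (2 * int t - 1)\<^sup>2"

definition omega_minus :: "nat \<Rightarrow> int" where
  "omega_minus r = (3 * (int r)\<^sup>2 - int r) div 2"

definition omega_plus :: "nat \<Rightarrow> int" where
  "omega_plus r = (3 * (int r)\<^sup>2 + int r) div 2"

text \<open>The divisions are exact, and the cardinality is that of a finite set.\<close>

lemma two_omega_minus: "2 * omega_minus r = 3 * (int r)\<^sup>2 - int r"
  unfolding omega_minus_def by (rule dvd_mult_div_cancel) simp

lemma two_omega_plus: "2 * omega_plus r = 3 * (int r)\<^sup>2 + int r"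
  unfolding omega_plus_def by (rule dvd_mult_div_cancel) simp

lemma finite_restricted_partitions: "finite (restricted_partitions b a n)"
proof -
  have size_le: "size M \<le> sum_mset M" if "\<forall>x\<in>#M. 0 < x" for M :: "nat multiset"
    using that by (induction M) auto
  have "restricted_partitions b a n \<subseteq>
      (\<Union>k\<le>nat n. multisets_of_size {..nat n} k)"
  proof
    fix M assume "M \<in> restricted_partitions b a n"
    then have s: "int (sum_mset M) = n" and pos: "\<forall>x\<in>#M. 0 < x"
      by (auto simp: restricted_partitions_def)
    have "x \<le> nat n" if "x \<in># M" for x
      using s sum_mset.remove[OF that] by linarith
    moreover have "size M \<le> nat n"
      using size_le[OF pos] s by linarith
    ultimately show "M \<in> (\<Union>k\<le>nat n. multisets_of_size {..nat n} k)"
      by (auto simp: multisets_of_size_def)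
  qed
  moreover have "finite (multisets_of_size {..nat n} k)" for k
    by (rule finite_multisets_of_size) simp
  ultimately show ?thesis
    by (meson finite_UN_I finite_atMost finite_subset)
qed

lemma partition_count_0: "partition_count b a 0 = 1"
proof -
  have "M = {#}" if "M \<in> restricted_partitions b a 0" for M
  proof (rule ccontr)
    assume "M \<noteq> {#}"
    then obtain x where x: "x \<in># M" by blast
    moreover have "int (sum_mset M) = 0" and "\<forall>x\<in>#M. 0 < x"
      using that unfolding restricted_partitions_def by blast+
    ultimately have "0 < x" and "sum_mset M = 0"
      by (blast, linarith)
    then show False using sum_mset.remove[OF x] by linarith
  qed
  moreover have "{#} \<in> restricted_partitions b a 0"
    by (simp add: restricted_partitions_def)
  ultimately have "restricted_partitions b a 0 = {{#}}" by blast
  then show ?thesis by (simp add: partition_count_def)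
qed

lemma partition_count_neg: "n < 0 \<Longrightarrow> partition_count b a n = 0"
proof -
  assume "n < 0"
  then have "int (sum_mset M) \<noteq> n" for M by linarith
  then have "restricted_partitions b a n = {}"
    unfolding restricted_partitions_def by blast
  then show ?thesis by (simp add: partition_count_def)
qed

end

theory Submission
  imports Defs "HOL-Computational_Algebra.Formal_Power_Series"
begin

text \<open>
  Write \<open>k = 2 * t - 1\<close>. Splitting the exponents \<open>m = k * j + r\<close> of the pentagonal number series
  \<open>\<Sum>m. (-1)^m q^(m * (3 * m + 1) / 2)\<close> by the residue \<open>r\<close> with \<open>\<bar>r\<bar> < t\<close> gives again theta series
  in \<open>j\<close>, which by the Jacobi triple product are the products over the parts excluded modulo
  \<open>3 * k^2\<close>. Dividing by \<open>\<Prod>m\<ge>1. (1 - q^m)\<close> turns the left hand side into \<open>1\<close> and each summand into a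
  generating function of restricted partitions. Modulo
  \<open>q^(n + 1)\<close> finite sums and products suffice.
\<close>

unbundle fps_syntax

subsection \<open>The triple product modulo a power\<close>

text \<open>The Gaussian binomial coefficient, given by the \<open>q\<close>-Pascal rule so that no
  division is required in a general commutative ring.\<close>

fun qbinomial :: "'a::comm_ring_1 \<Rightarrow> nat \<Rightarrow> nat \<Rightarrow> 'a" where
  "qbinomial q n 0 = 1"
| "qbinomial q 0 (Suc k) = 0"
| "qbinomial q (Suc n) (Suc k) = qbinomial q n k + q ^ Suc k * qbinomial q n (Suc k)"

text \<open>The finite \<open>q\<close>-Pochhammer symbol (q; q)_n.\<close>

definition qpoch :: "'a::comm_ring_1 \<Rightarrow> nat \<Rightarrow> 'a" where
  "qpoch q n = (\<Prod>i<n. 1 - q ^ Suc i)"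

lemma qpoch_0 [simp]: "qpoch q 0 = 1"
  by (simp add: qpoch_def)

lemma qpoch_Suc: "qpoch q (Suc n) = qpoch q n * (1 - q ^ Suc n)"
  by (simp add: qpoch_def)

lemma qbinomial_eq_0: "n < k \<Longrightarrow> qbinomial q n k = 0"
  by (induction q n k rule: qbinomial.induct) auto

lemma Suc_choose_2: "Suc k choose 2 = (k choose 2) + k"
  by (simp add: numeral_2_eq_2)

lemma zero_choose_2 [simp]: "0 choose 2 = 0"
  by (simp add: numeral_2_eq_2)

text \<open>Splitting off the factor \<open>x + y\<close> leaves the same product with
  \<open>y * q\<close> in place of \<open>y\<close>, so the induction generalizes over
  \<open>y\<close>. The \<open>q\<close>-Pascal rule then merges the two resulting sums.\<close>

lemma qbinomial_theorem:
  "(\<Prod>i<n. x + y * q ^ i) =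
    (\<Sum>k\<le>n. q ^ (k choose 2) * qbinomial q n k * y ^ k * x ^ (n - k))"
proof (induction n arbitrary: y)
  case (Suc n)
  let ?f = "\<lambda>k. q ^ (k choose 2) * qbinomial q n k * (y * q) ^ k"
  have "(\<Prod>i<Suc n. x + y * q ^ i) = (x + y) * (\<Prod>i<n. x + (y * q) * q ^ i)"
    by (subst prod.lessThan_Suc_shift) (simp add: mult.assoc)
  also have "\<dots> = (x + y) * (\<Sum>k\<le>n. ?f k * x ^ (n - k))"
    by (subst Suc.IH) simp
  also have "\<dots> = (\<Sum>k\<le>n. ?f k * x ^ (Suc n - k)) + (\<Sum>k\<le>n. y * (?f k * x ^ (n - k)))"
    by (simp add: distrib_right sum_distrib_left Suc_diff_le sum.distrib mult_ac)
  also have "(\<Sum>k\<le>n. ?f k * x ^ (Suc n - k)) = (\<Sum>k\<le>Suc n. ?f k * x ^ (Suc n - k))"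
    by (simp add: qbinomial_eq_0)
  also have "\<dots> = x ^ Suc n + (\<Sum>k\<le>n. ?f (Suc k) * x ^ (n - k))"
    by (subst sum.atMost_Suc_shift) simp
  also have "\<dots> + (\<Sum>k\<le>n. y * (?f k * x ^ (n - k))) = x ^ Suc n +
      (\<Sum>k\<le>n. q ^ (Suc k choose 2) * qbinomial q (Suc n) (Suc k) * y ^ Suc k * x ^ (n - k))"
    by (simp add: sum.distrib [symmetric] add.assoc Suc_choose_2 power_add power_mult_distrib algebra_simps)
  also have "\<dots> = (\<Sum>k\<le>Suc n. q ^ (k choose 2) * qbinomial q (Suc n) k * y ^ k * x ^ (Suc n - k))"
    by (subst sum.atMost_Suc_shift) simp
  finally show ?case .
qed simp

text \<open>The quotient formula in division-free form. The two summands of the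
  \<open>q\<close>-Pascal rule contribute \<open>1 - q ^ Suc k\<close> and
  \<open>q ^ Suc k * (1 - q ^ (n - k))\<close>, which telescope to
  \<open>1 - q ^ Suc n\<close>.\<close>

lemma qbinomial_mult_qpoch:
  "k \<le> n \<Longrightarrow> qbinomial q n k * (qpoch q k * qpoch q (n - k)) = qpoch q n"
proof (induction q n k rule: qbinomial.induct)
  case (3 q n k)
  have first: "qbinomial q n k * (qpoch q (Suc k) * qpoch q (n - k)) = qpoch q n * (1 - q ^ Suc k)"
    using 3 by (simp add: qpoch_Suc flip: "3.IH"(1)) 
  have second: "qbinomial q n (Suc k) * (qpoch q (Suc k) * qpoch q (n - k)) =
      qpoch q n * (1 - q ^ (n - k))"
  \<comment> \<open>For \<open>k = n\<close> both sides vanish: the coefficient is out of range and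
    \<open>1 - q ^ 0 = 0\<close>.\<close>
  proof (cases "k = n")
    case False
    then have "n - k = Suc (n - Suc k)"
      using 3 by simp
    then show ?thesis
      using 3 False by (simp add: qpoch_Suc flip: "3.IH"(2))
  qed (simp add: qbinomial_eq_0)
  have "q ^ Suc k * q ^ (n - k) = q ^ Suc n"
    unfolding power_add[symmetric] using 3(3) by simp
  then have "qpoch q n * (1 - q ^ Suc k) + q ^ Suc k * (qpoch q n * (1 - q ^ (n - k))) =
      qpoch q (Suc n)"
    unfolding qpoch_Suc by (simp only: algebra_simps) (simp add: algebra_simps)
  then show ?case
    unfolding qbinomial.simps distrib_right mult.assoc diff_Suc_Suc first second .
qed auto

lemma dvd_diff_trans:
  fixes d :: "'a::comm_ring_1"
  assumes "d dvd x - y" and "d dvd y - z"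
  shows "d dvd x - z"
  using dvd_add[OF assms] by simp

lemma qpoch_cong:
  "m \<le> n \<Longrightarrow> q ^ Suc m dvd qpoch q n - qpoch q m"
proof (induction n rule: dec_induct)
  case (step n)
  have "q ^ Suc m dvd qpoch q n * q ^ Suc n"
    using step by (intro dvd_mult le_imp_power_dvd) simp
  then have "q ^ Suc m dvd (qpoch q n - qpoch q m) - qpoch q n * q ^ Suc n"
    using step.IH by (rule dvd_diff[rotated])
  then show ?case
    by (simp add: qpoch_Suc algebra_simps)
qed simp

lemma dvd_unit_mult_cancel:
  fixes u :: "'a::comm_ring_1"
  assumes "u dvd 1" and "d dvd u * x"
  shows "d dvd x"
proof -
  obtain v where "1 = u * v"
    using assms(1) by blast
  then have "x = u * x * v"
    by (metis mult.commute mult.left_commute mult_1)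
  then show ?thesis
    using assms(2) by (metis dvd_mult2)
qed

text \<open>Modulo \<open>q ^ Suc m\<close>, the symbols \<open>qpoch\<close> at \<open>k\<close>,
  \<open>2 * l - k\<close>, \<open>l\<close> and \<open>2 * l\<close> all agree with
  \<open>qpoch q m\<close>. The quotient formula thus becomes \<open>?B * (?Q m * ?Q m)\<close>
  congruent to \<open>?Q m\<close>, and one unit cancels.\<close>

lemma qbinomial_central_cong:
  assumes "k \<le> 2 * l" and "m = min k (2 * l - k)" and unit: "qpoch q m dvd 1"
  shows "q ^ Suc m dvd qbinomial q (2 * l) k * qpoch q l - 1"
proof -
  let ?B = "qbinomial q (2 * l) k" and ?Q = "qpoch q"
  have ml: "m \<le> l" "m \<le> k" "m \<le> 2 * l - k"
    using assms by auto
  have mult_cong: "d dvd a - a' \<Longrightarrow> d dvd b - b' \<Longrightarrow> d dvd a * b - a' * b'" for d a a' b b' :: 'a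
  proof -
    assume "d dvd a - a'" "d dvd b - b'"
    then have "d dvd (a - a') * b + a' * (b - b')" by simp
    then show ?thesis by (simp add: algebra_simps)
  qed
  have "q ^ Suc m dvd ?Q k * ?Q (2 * l - k) - ?Q m * ?Q m"
    using ml by (intro mult_cong qpoch_cong)
  then have "q ^ Suc m dvd ?B * (?Q k * ?Q (2 * l - k)) - ?B * (?Q m * ?Q m)"
    by (rule mult_cong[rotated]) simp
  then have "q ^ Suc m dvd ?Q (2 * l) - ?B * (?Q m * ?Q m)"
    using assms(1) by (simp add: qbinomial_mult_qpoch)
  moreover have "q ^ Suc m dvd ?Q (2 * l) - ?Q m"
    using ml by (intro qpoch_cong) simp
  ultimately have "q ^ Suc m dvd (?Q (2 * l) - ?Q m) - (?Q (2 * l) - ?B * (?Q m * ?Q m))"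
    by (rule dvd_diff[rotated])
  then have "q ^ Suc m dvd ?Q m * (?B * ?Q m - 1)"
    by (simp add: algebra_simps)
  then have "q ^ Suc m dvd ?B * ?Q m - 1"
    by (rule dvd_unit_mult_cancel[OF unit])
  moreover have "q ^ Suc m dvd ?B * ?Q l - ?B * ?Q m"
    using ml by (intro mult_cong qpoch_cong) simp_all
  ultimately show ?thesis
    by (rule dvd_diff_trans[rotated])
qed

section \<open>Theta sums and the truncated Jacobi triple product\<close>

definition triangle :: "int \<Rightarrow> nat" where
  "triangle j = nat (j * (j + 1) div 2)"

text \<open>The doubled form turns equations between exponents into polynomial identities over the
  integers, from which the factor 2 is cancelled afterwards.\<close>

lemma two_triangle: "2 * int (triangle j) = j * (j + 1)"
proof -
  have "0 \<le> j * (j + 1)"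
    by (cases "0 \<le> j") (auto simp: zero_le_mult_iff)
  then have "int (triangle j) = j * (j + 1) div 2"
    by (simp add: triangle_def)
  then show ?thesis by simp
qed

lemma two_choose_2: "2 * int (k choose 2) = int k * (int k - 1)"
  by (induction k) (auto simp: Suc_choose_2 algebra_simps)

text \<open>
  Ramanujan's theta function \<open>f(u, v) = \<Sum>j. u^(j * (j + 1) / 2) v^(j * (j - 1) / 2)\<close>; negating both
  arguments produces the signs \<open>(-1)^j\<close>.
\<close>

definition theta_term :: "'a::comm_ring_1 \<Rightarrow> 'a \<Rightarrow> int \<Rightarrow> 'a" where
  "theta_term u v j = u ^ triangle j * v ^ triangle (- j)"

definition theta_sum :: "nat \<Rightarrow> 'a::comm_ring_1 \<Rightarrow> 'a \<Rightarrow> 'a" where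
  "theta_sum l u v = (\<Sum>j=-int l..int l. theta_term u v j)"

text \<open>
  This is the homogeneous \<open>q\<close>-binomial theorem for \<open>(q^l + v) \<dots> (q^l + v * q^(2 * l - 1))\<close> after
  cancelling the monomial \<open>c\<close>.
\<close>

lemma finite_triple_product:
  fixes u v :: "'a::idom"
  assumes "u \<noteq> 0" and "v \<noteq> 0" and q: "q = u * v"
  shows "(\<Prod>i<l. (1 + u * q ^ i) * (1 + v * q ^ i)) =
    (\<Sum>j=-int l..int l. qbinomial q (2 * l) (nat (int l - j)) * theta_term u v j)"
proof -
  \<comment> \<open>Pulling \<open>v * q ^ i\<close> out of each of the first \<open>l\<close>
    factors gives \<open>v ^ l * q ^ (l choose 2)\<close>; pulling \<open>q ^ l\<close> out of each
    of the last \<open>l\<close> gives \<open>q ^ (l * l)\<close>.\<close>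
  define c where "c = v ^ l * q ^ (l choose 2) * q ^ (l * l)"
  let ?P = "\<Prod>i<l. (1 + u * q ^ i) * (1 + v * q ^ i)"
  have c0: "c \<noteq> 0"
    using assms by (simp add: c_def)
  have "{..<2 * l} = {..<l} \<union> {l..<2 * l}"
    by auto
  then have "(\<Prod>i<2 * l. q ^ l + v * q ^ i) =
      (\<Prod>i<l. q ^ l + v * q ^ i) * (\<Prod>i\<in>{l..<2 * l}. q ^ l + v * q ^ i)"
    by (simp add: prod.union_disjoint ivl_disj_int)
  also have "(\<Prod>i\<in>{l..<2 * l}. q ^ l + v * q ^ i) = (\<Prod>i<l. q ^ l * (1 + v * q ^ i))"
    by (rule prod.reindex_bij_witness[of _ "\<lambda>i. i + l" "\<lambda>i. i - l"])
      (auto simp: algebra_simps simp flip: power_add)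
  also have "\<dots> = q ^ (l * l) * (\<Prod>i<l. 1 + v * q ^ i)"
    by (simp add: prod.distrib power_mult)
  also have "(\<Prod>i<l. q ^ l + v * q ^ i) = (\<Prod>i<l. v * q ^ i * (1 + u * q ^ (l - Suc i)))"
  proof (rule prod.cong)
    fix i assume "i \<in> {..<l}"
    then have "q ^ l = q ^ i * (q * q ^ (l - Suc i))"
      by (simp flip: power_add power_Suc)
    then show "q ^ l + v * q ^ i = v * q ^ i * (1 + u * q ^ (l - Suc i))"
      by (simp add: algebra_simps q)
  qed simp
  also have "\<dots> = v ^ l * (\<Prod>i<l. q ^ i) * (\<Prod>i<l. 1 + u * q ^ (l - Suc i))"
    by (simp add: prod.distrib)
  also have "(\<Prod>i<l. 1 + u * q ^ (l - Suc i)) = (\<Prod>i<l. 1 + u * q ^ i)"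
    by (rule prod.nat_diff_reindex)
  also have "(\<Prod>i<l. q ^ i) = q ^ (l choose 2)"
    by (induction l) (auto simp: Suc_choose_2 power_add binomial_eq_0)
  finally have "c * ?P = (\<Prod>i<2 * l. q ^ l + v * q ^ i)"
    by (simp add: c_def prod.distrib mult_ac)
  also have "\<dots> = (\<Sum>k\<le>2 * l. q ^ (k choose 2) * qbinomial q (2 * l) k * v ^ k * (q ^ l) ^ (2 * l - k))"
    by (rule qbinomial_theorem)
  also have "\<dots> = (\<Sum>j=-int l..int l. c * (qbinomial q (2 * l) (nat (int l - j)) * theta_term u v j))"
  proof (rule sum.reindex_bij_witness[of _ "\<lambda>j. nat (int l - j)" "\<lambda>k. int l - int k"])
    fix k assume k: "k \<in> {..2 * l}"
    define j where "j = int l - int k"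
    \<comment> \<open>After \<open>c\<close> is split off, the power of \<open>q\<close> left over
      is \<open>triangle j\<close>. It contributes \<open>triangle j\<close> to both
      \<open>u\<close> and \<open>v\<close>; the second identity \<open>ev\<close> combines the part
      for \<open>v\<close> with \<open>v ^ k\<close>.\<close>
    have "2 * int ((k choose 2) + l * (2 * l - k)) = 2 * int ((l choose 2) + l * l + triangle j)"
      using k unfolding of_nat_add of_nat_mult distrib_left two_choose_2 two_triangle j_def
      by (simp add: of_nat_diff algebra_simps)
    then have eu: "(k choose 2) + l * (2 * l - k) = (l choose 2) + l * l + triangle j"
      by (simp only: mult_cancel_left of_nat_eq_iff) simp
    have "2 * int (triangle j + k) = 2 * int (l + triangle (- j))"
      unfolding of_nat_add distrib_left two_triangle j_def by (simp add: algebra_simps)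
    then have ev: "triangle j + k = l + triangle (- j)"
      by (simp only: mult_cancel_left of_nat_eq_iff) simp
    have "q ^ (k choose 2) * v ^ k * (q ^ l) ^ (2 * l - k) =
        q ^ ((k choose 2) + l * (2 * l - k)) * v ^ k"
      by (simp add: power_add power_mult mult_ac)
    also have "\<dots> = q ^ ((l choose 2) + l * l) * u ^ triangle j * v ^ (triangle j + k)"
      unfolding eu by (simp add: power_add q power_mult_distrib mult_ac)
    also have "\<dots> = c * theta_term u v j"
      unfolding ev by (simp add: c_def theta_term_def power_add mult_ac)
    finally show "c * (qbinomial q (2 * l) (nat (int l - (int l - int k))) *
        theta_term u v (int l - int k)) =
        q ^ (k choose 2) * qbinomial q (2 * l) k * v ^ k * (q ^ l) ^ (2 * l - k)"
      by (simp add: j_def mult_ac)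
  qed auto
  finally show ?thesis
    using c0 by (simp flip: sum_distrib_left)
qed

text \<open>The exponents of \<open>u\<close> and \<open>v\<close> add up to \<open>j * j\<close>,
  which is at least \<open>\<bar>j\<bar>\<close>.\<close>

lemma power_dvd_theta_term:
  assumes "x dvd u" and "x dvd v"
  shows "x ^ nat \<bar>j\<bar> dvd theta_term u v j"
proof -
  have "2 * int (triangle j + triangle (- j)) = 2 * (j * j)"
    unfolding of_nat_add distrib_left two_triangle by (simp add: algebra_simps)
  moreover have "\<bar>j\<bar> * 1 \<le> \<bar>j\<bar> * \<bar>j\<bar>"
    by (cases "j = 0") (auto intro!: mult_left_mono simp del: mult_1_right abs_mult_self_eq)
  ultimately have "nat \<bar>j\<bar> \<le> triangle j + triangle (- j)"
    by (simp add: abs_mult_self_eq)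
  then have "x ^ nat \<bar>j\<bar> dvd x ^ triangle j * x ^ triangle (- j)"
    unfolding power_add[symmetric] by (rule le_imp_power_dvd)
  also have "\<dots> dvd theta_term u v j"
    unfolding theta_term_def using assms by (intro mult_dvd_mono dvd_power_same)
  finally show ?thesis .
qed

lemma theta_sum_cong:
  assumes "x dvd u" and "x dvd v" and "l \<le> m"
  shows "x ^ Suc l dvd theta_sum m u v - theta_sum l u v"
proof -
  have "theta_sum m u v - theta_sum l u v =
      (\<Sum>j\<in>{-int m..int m} - {-int l..int l}. theta_term u v j)"
    unfolding theta_sum_def using assms(3) by (subst sum_diff) auto
  also have "x ^ Suc l dvd \<dots>"
  proof (rule dvd_sum)
    fix j assume "j \<in> {-int m..int m} - {-int l..int l}"
    then have "x ^ Suc l dvd x ^ nat \<bar>j\<bar>"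
      by (intro le_imp_power_dvd) auto
    then show "x ^ Suc l dvd theta_term u v j"
      using power_dvd_theta_term[OF assms(1,2)] by (rule dvd_trans)
  qed
  finally show ?thesis .
qed

text \<open>Each term splits the required power of \<open>x\<close>: the theta term supplies
  \<open>\<bar>j\<bar>\<close> factors, and the deviation of its coefficient from 1 supplies the
  remaining \<open>l - \<bar>j\<bar> + 1\<close>, since \<open>x\<close> divides
  \<open>q\<close>.\<close>

lemma triple_product_cong:
  fixes u v :: "'a::idom"
  assumes "u \<noteq> 0" and "v \<noteq> 0" and q: "q = u * v" and "x dvd u" and "x dvd v"
    and unit: "\<And>m. qpoch q m dvd 1"
  shows "x ^ Suc l dvd
    (\<Prod>i<l. (1 + u * q ^ i) * (1 + v * q ^ i) * (1 - q ^ Suc i)) - theta_sum l u v"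
proof -
  let ?B = "\<lambda>j. qbinomial q (2 * l) (nat (int l - j))"
  have "(\<Prod>i<l. (1 + u * q ^ i) * (1 + v * q ^ i) * (1 - q ^ Suc i)) =
      (\<Prod>i<l. (1 + u * q ^ i) * (1 + v * q ^ i)) * qpoch q l"
    by (simp only: prod.distrib qpoch_def)
  then have "(\<Prod>i<l. (1 + u * q ^ i) * (1 + v * q ^ i) * (1 - q ^ Suc i)) - theta_sum l u v =
      (\<Sum>j=-int l..int l. (?B j * qpoch q l - 1) * theta_term u v j)"
    unfolding finite_triple_product[OF assms(1-3)] theta_sum_def
    by (simp only: left_diff_distrib sum_subtractf mult_1_left)
      (simp only: sum_distrib_left sum_distrib_right mult_ac)
  also have "x ^ Suc l dvd \<dots>"
  proof (rule dvd_sum)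
    fix j assume j: "j \<in> {-int l..int l}"
    \<comment> \<open>With \<open>k = l - j\<close>, the minimum of \<open>k\<close> and
      \<open>2 * l - k\<close> is \<open>l - \<bar>j\<bar>\<close>.\<close>
    define m where "m = l - nat \<bar>j\<bar>"
    have "q ^ Suc m dvd ?B j * qpoch q l - 1"
      using j by (intro qbinomial_central_cong unit) (auto simp: m_def min_def)
    moreover have "x ^ Suc m dvd q ^ Suc m"
      using assms(4) by (intro dvd_power_same) (simp add: q)
    ultimately have "x ^ Suc m dvd ?B j * qpoch q l - 1"
      by (rule dvd_trans[rotated])
    then have "x ^ Suc m * x ^ nat \<bar>j\<bar> dvd (?B j * qpoch q l - 1) * theta_term u v j"
      using power_dvd_theta_term[OF assms(4,5)] by (rule mult_dvd_mono)
    moreover have "Suc l = Suc m + nat \<bar>j\<bar>"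
      using j unfolding m_def atLeastAtMost_iff by linarith
    ultimately show "x ^ Suc l dvd (?B j * qpoch q l - 1) * theta_term u v j"
      by (simp only: power_add)
  qed
  finally show ?thesis .
qed

subsection \<open>Dissection of theta sums\<close>

lemma theta_term_dissection:
  fixes u v :: "'a::comm_ring_1" and j r :: int
  assumes k: "k = 2 * s + 1" and r: "r \<in> {-int s..int s}"
  shows "theta_term u v (int k * j + r) = theta_term u v r *
    theta_term (u ^ nat (int k * (int s + 1 + r)) * v ^ nat (int k * (int s + r)))
      (u ^ nat (int k * (int s - r)) * v ^ nat (int k * (int s + 1 - r))) j"
proof -
  \<comment> \<open>A quadratic polynomial in \<open>i\<close> without constant term is a
    combination of \<open>i * (i + 1) / 2\<close> and \<open>i * (i - 1) / 2\<close>. Here the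
    coefficients are integral because \<open>k\<close> is odd, and nonnegative because
    \<open>\<bar>p\<bar> \<le> s\<close>, so \<open>nat\<close> loses nothing.\<close>
  have *: "triangle (int k * i + p) =
      triangle p + nat (int k * (int s + 1 + p)) * triangle i + nat (int k * (int s - p)) * triangle (- i)"
    if "p \<in> {-int s..int s}" for i p
  proof -
    have "2 * int (triangle (int k * i + p)) =
        2 * int (triangle p) + int k * (int s + 1 + p) * (2 * int (triangle i)) +
        int k * (int s - p) * (2 * int (triangle (- i)))"
      unfolding two_triangle k by (simp add: algebra_simps)
    then have "2 * int (triangle (int k * i + p)) = 2 * int (triangle p +
        nat (int k * (int s + 1 + p)) * triangle i + nat (int k * (int s - p)) * triangle (- i))"
      using that by simp
    then show ?thesis
      by (simp only: mult_cancel_left of_nat_eq_iff) simp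
  qed
  have "triangle (- (int k * j + r)) = triangle (- r) +
      nat (int k * (int s + 1 - r)) * triangle (- j) + nat (int k * (int s + r)) * triangle j"
    using *[of "- r" "- j"] r by simp
  then show ?thesis
    using *[OF r, of j]
    by (simp add: theta_term_def power_add power_mult_distrib mult_ac flip: power_mult)
qed

text \<open>The numbers \<open>k * j + r\<close> with \<open>\<bar>j\<bar> \<le> l\<close> and
  \<open>\<bar>r\<bar> \<le> s\<close> fill the interval up to \<open>k * l + s\<close> in absolute
  value exactly once, so the dissection is exact for finite sums.\<close>

lemma theta_sum_dissection:
  fixes u v :: "'a::comm_ring_1"
  assumes k: "k = 2 * s + 1"
  shows "theta_sum (k * l + s) u v = (\<Sum>r=-int s..int s. theta_term u v r *
    theta_sum l (u ^ nat (int k * (int s + 1 + r)) * v ^ nat (int k * (int s + r)))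
      (u ^ nat (int k * (int s - r)) * v ^ nat (int k * (int s + 1 - r))))"
proof -
  have "(\<Sum>r=-int s..int s. \<Sum>j=-int l..int l. theta_term u v (int k * j + r)) =
      theta_sum (k * l + s) u v"
    unfolding theta_sum_def sum.cartesian_product
  \<comment> \<open>Shifting by \<open>s\<close> before dividing turns the balanced remainder
    \<open>r\<close> into the ordinary remainder modulo \<open>k\<close>.\<close>
  proof (rule sum.reindex_bij_witness[of _
        "\<lambda>m. ((m + int s) mod int k - int s, (m + int s) div int k)" "\<lambda>(r, j). int k * j + r"])
    fix p :: "int \<times> int"
    assume "p \<in> {-int s..int s} \<times> {-int l..int l}"
    then obtain r j where p: "p = (r, j)" "r \<in> {-int s..int s}" "j \<in> {-int l..int l}"
      by auto
    have "int k * j \<le> int k * int l" "int k * (- int l) \<le> int k * j"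
      using p by (auto intro!: mult_left_mono simp del: mult_minus_right)
    then show "(case p of (r, j) \<Rightarrow> int k * j + r) \<in> {-int (k * l + s)..int (k * l + s)}"
      using p by simp
    have "(int k * j + r + int s) div int k = j" "(int k * j + r + int s) mod int k = r + int s"
      using p k by (auto simp: add.assoc div_pos_pos_trivial mod_pos_pos_trivial)
    then show "(((case p of (r, j) \<Rightarrow> int k * j + r) + int s) mod int k - int s,
        ((case p of (r, j) \<Rightarrow> int k * j + r) + int s) div int k) = p"
      by (simp add: p)
  next
    fix m assume m: "m \<in> {-int (k * l + s)..int (k * l + s)}"
    define d where "d = (m + int s) div int k"
    define e where "e = (m + int s) mod int k"
    have e: "0 \<le> e" "e < int k" and de: "m + int s = int k * d + e"
      using k by (auto simp: d_def e_def)
    have "int k * d < int k * (int l + 1)" "int k * (- int l - 1) < int k * d"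
      using m e de k by (auto simp: algebra_simps)
    then have "d < int l + 1" "- int l - 1 < d"
      using k by (simp_all only: mult_less_cancel_left_pos)
    then show "((m + int s) mod int k - int s, (m + int s) div int k) \<in>
        {-int s..int s} \<times> {-int l..int l}"
      using e unfolding d_def[symmetric] e_def[symmetric] by (auto simp: k)
  qed (simp_all add: algebra_simps case_prod_beta)
  also have "(\<Sum>r=-int s..int s. \<Sum>j=-int l..int l. theta_term u v (int k * j + r)) =
      (\<Sum>r=-int s..int s. theta_term u v r *
    theta_sum l (u ^ nat (int k * (int s + 1 + r)) * v ^ nat (int k * (int s + r)))
      (u ^ nat (int k * (int s - r)) * v ^ nat (int k * (int s + 1 - r))))"
    unfolding theta_sum_def sum_distrib_left
    by (intro sum.cong refl theta_term_dissection k)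
  finally show ?thesis ..
qed

subsection \<open>Generating functions of restricted partitions\<close>

lemma fps_dvd_1:
  fixes f :: "'a::comm_ring_1 fps"
  assumes "f $ 0 = 1"
  shows "f dvd 1"
  using fps_right_inverse[of f 1] assms by (metis dvd_triv_left mult_1)

lemma fps_nth_eq_of_dvd_diff:
  fixes f g :: "'a::comm_ring_1 fps"
  assumes "fps_X ^ Suc l dvd f - g" and "n \<le> l"
  shows "f $ n = g $ n"
proof -
  obtain h where "f - g = fps_X ^ Suc l * h"
    using assms(1) by blast
  then have "(f - g) $ n = 0"
    using assms(2) by (simp add: fps_X_power_mult_nth del: power_Suc)
  then show ?thesis by simp
qed

section \<open>Euler products over the excluded parts\<close>

definition excluded :: "int \<Rightarrow> int \<Rightarrow> nat \<Rightarrow> bool" where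
  "excluded b a x \<longleftrightarrow> [int x = 0] (mod b) \<or> [int x = a] (mod b) \<or> [int x = - a] (mod b)"

lemma excluded_add_mult [simp]: "excluded b a (nat b * i + x) = excluded b a x" if "0 \<le> b"
  using that by (simp add: excluded_def cong_def)

text \<open>One period of the modulus \<open>a + c\<close>, in which \<open>c\<close> represents the
  residue \<open>- a\<close>.\<close>

lemma excluded_iff:
  assumes "0 < a" and "0 < c" and x: "0 < x" "x \<le> a + c"
  shows "excluded (int (a + c)) (int a) x \<longleftrightarrow> x = a \<or> x = c \<or> x = a + c"
proof
  assume "excluded (int (a + c)) (int a) x"
  then consider "int (a + c) dvd int x" | "int (a + c) dvd int x - int a" | "int (a + c) dvd int x + int a"
    by (auto simp: excluded_def cong_iff_dvd_diff)
  then show "x = a \<or> x = c \<or> x = a + c"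
  proof cases
    case 1
    then have "int (a + c) \<le> int x"
      using x by (intro zdvd_imp_le) auto
    then show ?thesis using x by simp
  next
    case 2
    moreover have "\<bar>int x - int a\<bar> < \<bar>int (a + c)\<bar>"
      using assms by auto
    ultimately have "int x - int a = 0"
      using dvd_imp_le_int linorder_not_le by blast
    then show ?thesis by simp
  next
    case 3
    then obtain d where d: "int x + int a = int (a + c) * d" by blast
    \<comment> \<open>Since \<open>x \<le> a + c\<close> and \<open>a < a + c\<close>, the multiple
      \<open>x + a\<close> lies strictly between 0 and twice the modulus.\<close>
    have "int (a + c) * 0 < int (a + c) * d" "int (a + c) * d < int (a + c) * 2"
      using assms unfolding d[symmetric] by simp_all
    then have "0 < d" "d < 2"
      using assms(1) by (simp_all only: mult_less_cancel_left_pos)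
    then have "d = 1" by simp
    then show ?thesis using d by simp
  qed
qed (auto simp: excluded_def cong_iff_dvd_diff add.commute)

text \<open>Each period of length \<open>b\<close> adds three excluded numbers, distinct because
  \<open>a \<noteq> c\<close>; they are grouped as in the triple product.\<close>

lemma prod_excluded:
  fixes f :: "nat \<Rightarrow> 'a::comm_monoid_mult"
  assumes "0 < a" and "0 < c" and "a \<noteq> c" and b: "b = a + c"
  shows "prod f {x\<in>{1..b * l}. excluded (int b) (int a) x} =
    (\<Prod>i<l. f (c + b * i) * f (a + b * i) * f (b * Suc i))"
proof (induction l)
  case (Suc l)
  have "{x\<in>{1..b * Suc l}. excluded (int b) (int a) x} =
      {x\<in>{1..b * l}. excluded (int b) (int a) x} \<union> {c + b * l, a + b * l, b * Suc l}"
    (is "?S = ?T \<union> ?U")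
  proof (intro set_eqI)
    fix x
    show "x \<in> ?S \<longleftrightarrow> x \<in> ?T \<union> ?U"
    proof (cases "x \<le> b * l")
      case True
      then show ?thesis using assms by auto
    next
      case False
      define y where "y = x - b * l"
      have x: "x = b * l + y" and y: "0 < y"
        using False by (auto simp: y_def)
      have "excluded (int b) (int a) x = excluded (int b) (int a) y"
        unfolding x using excluded_add_mult[of "int b" "int a" l y] by simp
      then show ?thesis
        using excluded_iff[OF assms(1,2), of y] y False assms(1,2)
        by (auto simp: x b)
    qed
  qed
  moreover have "?T \<inter> ?U = {}"
    using assms by auto
  moreover have "prod f ?U = f (c + b * l) * f (a + b * l) * f (b * Suc l)"
    using assms by (simp add: mult.assoc)
  ultimately have "prod f ?S = prod f ?T * (f (c + b * l) * f (a + b * l) * f (b * Suc l))"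
    using prod.union_disjoint[of ?T ?U f] by simp
  then show ?case
    unfolding Suc by simp
qed simp

abbreviation euler_factors :: "nat set \<Rightarrow> int fps" where
  "euler_factors S \<equiv> (\<Prod>x\<in>S. 1 - fps_X ^ x)"

text \<open>The truncated triple product at \<open>u = - (fps_X ^ c)\<close> and
  \<open>v = - (fps_X ^ a)\<close>, whose base \<open>u * v\<close> is
  \<open>fps_X ^ b\<close>.\<close>

lemma excluded_product_cong:
  assumes "0 < a" and "0 < c" and "a \<noteq> c" and b: "b = a + c"
  shows "fps_X ^ Suc l dvd euler_factors {x\<in>{1..b * l}. excluded (int b) (int a) x} -
    theta_sum l (- (fps_X ^ c)) (- (fps_X ^ a))"
proof -
  define q :: "int fps" where "q = fps_X ^ b"
  have q: "q = - (fps_X ^ c) * - (fps_X ^ a)"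
    by (simp add: q_def b power_add mult.commute)
  have "qpoch q m $ 0 = 1" for m
    using assms by (induction m) (simp_all add: qpoch_Suc q_def)
  then have "fps_X ^ Suc l dvd
      (\<Prod>i<l. (1 + - (fps_X ^ c) * q ^ i) * (1 + - (fps_X ^ a) * q ^ i) * (1 - q ^ Suc i)) -
      theta_sum l (- (fps_X ^ c)) (- (fps_X ^ a))"
    using assms q by (intro triple_product_cong fps_dvd_1) (auto intro: dvd_power)
  also have "(\<Prod>i<l. (1 + - (fps_X ^ c) * q ^ i) * (1 + - (fps_X ^ a) * q ^ i) * (1 - q ^ Suc i)) =
      euler_factors {x\<in>{1..b * l}. excluded (int b) (int a) x}"
    unfolding prod_excluded[OF assms] q_def power_mult[symmetric] power_add by simp
  finally show ?thesis .
qed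

section \<open>Generating functions for a set of admissible parts\<close>

definition partitions_into :: "nat set \<Rightarrow> nat \<Rightarrow> nat multiset set" where
  "partitions_into S n = {M. set_mset M \<subseteq> S \<and> sum_mset M = n}"

definition partition_gf :: "nat set \<Rightarrow> int fps" where
  "partition_gf S = Abs_fps (\<lambda>n. int (card (partitions_into S n)))"

lemma finite_partitions_into:
  assumes "0 \<notin> S"
  shows "finite (partitions_into S n)"
proof (rule finite_subset)
  \<comment> \<open>Congruence modulo 0 is equality, so modulus 0 and residue 0 forbid only the part
    0.\<close>
  show "partitions_into S n \<subseteq> restricted_partitions 0 0 (int n)"
    using assms by (auto simp: partitions_into_def restricted_partitions_def intro: gr0I)
qed (rule finite_restricted_partitions)

text \<open>Partitions containing \<open>x\<close> correspond to those of \<open>n - x\<close> by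
  removing one copy of \<open>x\<close>.\<close>

lemma card_partitions_into_insert:
  assumes "0 \<notin> insert x S" and "x \<notin> S"
  shows "card (partitions_into (insert x S) n) = card (partitions_into S n) +
    (if x \<le> n then card (partitions_into (insert x S) (n - x)) else 0)"
proof -
  have add: "add_mset x ` partitions_into (insert x S) (n - x) =
      {M \<in> partitions_into (insert x S) n. x \<in># M}" if "x \<le> n"
  proof (intro equalityI subsetI)
    fix M assume M: "M \<in> {M \<in> partitions_into (insert x S) n. x \<in># M}"
    then obtain N where N: "M = add_mset x N"
      by (auto dest: multi_member_split)
    then have "N \<in> partitions_into (insert x S) (n - x)"
      using M by (auto simp: partitions_into_def)
    then show "M \<in> add_mset x ` partitions_into (insert x S) (n - x)"
      using N by blast
  qed (use that in \<open>auto simp: partitions_into_def\<close>)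
  have none: "{M \<in> partitions_into (insert x S) n. x \<in># M} = {}" if "\<not> x \<le> n"
    using that by (auto simp: partitions_into_def dest!: multi_member_split)
  have "partitions_into (insert x S) n =
      partitions_into S n \<union> {M \<in> partitions_into (insert x S) n. x \<in># M}"
    by (auto simp: partitions_into_def)
  moreover have "partitions_into S n \<inter> {M \<in> partitions_into (insert x S) n. x \<in># M} = {}"
    using assms(2) by (auto simp: partitions_into_def)
  moreover have "finite (partitions_into (insert x S) n)" "finite (partitions_into S n)"
    using assms(1) by (auto intro: finite_partitions_into)
  ultimately have "card (partitions_into (insert x S) n) = card (partitions_into S n) +
      card {M \<in> partitions_into (insert x S) n. x \<in># M}"
    by (metis (no_types, lifting) card_Un_disjoint finite_Un)
  also have "card {M \<in> partitions_into (insert x S) n. x \<in># M} =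
      (if x \<le> n then card (partitions_into (insert x S) (n - x)) else 0)"
    by (cases "x \<le> n") (simp_all add: none card_image inj_on_def flip: add)
  finally show ?thesis .
qed

text \<open>By the preceding recurrence, multiplication by \<open>1 - fps_X ^ x\<close> removes
  \<open>x\<close> from the admissible parts; repeating this leaves only the empty
  partition.\<close>

lemma partition_gf_mult_euler_factors:
  assumes "finite S" and "0 \<notin> S"
  shows "partition_gf S * euler_factors S = 1"
  using assms
proof (induction S)
  case empty
  have "partitions_into {} n = (if n = 0 then {{#}} else {})" for n
    by (auto simp: partitions_into_def)
  then show ?case
    by (simp add: partition_gf_def fps_eq_iff)
next
  case (insert x S)
  have "partition_gf (insert x S) * (1 - fps_X ^ x) = partition_gf S"
  proof (rule fps_ext)
    fix n
    have "(partition_gf (insert x S) * (1 - fps_X ^ x)) $ n =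
        partition_gf (insert x S) $ n - (partition_gf (insert x S) * fps_X ^ x) $ n"
      by (simp add: right_diff_distrib)
    then show "(partition_gf (insert x S) * (1 - fps_X ^ x)) $ n = partition_gf S $ n"
      using card_partitions_into_insert[OF insert.prems insert.hyps(2), of n]
      by (simp add: fps_X_power_mult_right_nth partition_gf_def not_le)
  qed
  then show ?case
    using insert by (simp flip: mult.assoc)
qed

lemma partition_gf_mult_euler_factors_superset:
  assumes "finite T" and "0 \<notin> T" and "S \<subseteq> T"
  shows "partition_gf S * euler_factors T = euler_factors (T - S)"
proof -
  have "euler_factors T = euler_factors (T - S) * euler_factors S"
    by (rule prod.subset_diff[OF assms(3,1)])
  then have "partition_gf S * euler_factors T =
      euler_factors (T - S) * (partition_gf S * euler_factors S)"
    by (simp only: mult_ac)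
  then show ?thesis
    using assms by (subst (asm) partition_gf_mult_euler_factors) (auto intro: finite_subset)
qed

text \<open>No part exceeds the partitioned number, so a bound \<open>N \<ge> m\<close> on the parts
  changes nothing.\<close>

lemma partitions_into_eq_restricted_partitions:
  assumes "m \<le> N"
  shows "partitions_into {x\<in>{1..N}. \<not> excluded b a x} m = restricted_partitions b a (int m)"
proof (intro set_eqI iffI)
  fix M assume M: "M \<in> restricted_partitions b a (int m)"
  then have sum: "sum_mset M = m"
    unfolding restricted_partitions_def mem_Collect_eq of_nat_eq_iff by blast
  then have "x \<le> N" if "x \<in># M" for x
    using sum_mset.remove[OF that] assms sum by linarith
  then show "M \<in> partitions_into {x\<in>{1..N}. \<not> excluded b a x} m"
    using M sum by (auto simp: partitions_into_def restricted_partitions_def excluded_def Suc_le_eq)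
qed (auto simp: partitions_into_def restricted_partitions_def excluded_def Suc_le_eq)

lemma fps_X_power_mult_partition_gf_nth:
  assumes "n \<le> N"
  shows "(fps_X ^ w * partition_gf {x\<in>{1..N}. \<not> excluded b a x}) $ n =
    int (partition_count b a (int n - int w))"
proof (cases "w \<le> n")
  case True
  then show ?thesis
    using assms partitions_into_eq_restricted_partitions[of "n - w" N b a]
    by (simp add: fps_X_power_mult_nth partition_gf_def partition_count_def of_nat_diff)
qed (simp add: fps_X_power_mult_nth partition_count_neg)

section \<open>Assembling the recurrence\<close>

lemma partition_count_mod_minus: "partition_count b (b - a) n = partition_count b a n"
proof -
  have "[x = b - a] (mod b) \<longleftrightarrow> [x = - a] (mod b)" "[x = - (b - a)] (mod b) \<longleftrightarrow> [x = a] (mod b)" for x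
    by (simp_all add: cong_def mod_diff_eq[symmetric] flip: mod_diff_left_eq)
  then have "restricted_partitions b (b - a) n = restricted_partitions b a n"
    by (auto simp: restricted_partitions_def)
  then show ?thesis
    by (simp add: partition_count_def)
qed

lemma sum_symmetric_interval:
  fixes f :: "int \<Rightarrow> 'a::comm_monoid_add"
  shows "(\<Sum>r=-int s..int s. f r) = f 0 + (\<Sum>r=1..s. f (- int r) + f (int r))"
proof (induction s)
  case (Suc s)
  have "{-int (Suc s)..int (Suc s)} = insert (- int (Suc s)) (insert (int (Suc s)) {-int s..int s})"
    by auto
  then have "(\<Sum>r=-int (Suc s)..int (Suc s). f r) =
      f (- int (Suc s)) + (f (int (Suc s)) + (\<Sum>r=-int s..int s. f r))"
    by simp
  then show ?case
    by (simp only: Suc.IH sum.cl_ivl_Suc) (simp add: ac_simps)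
qed simp

text \<open>The recurrence in symmetric form: \<open>w r\<close> is the pentagonal number
  \<open>r * (3 * r + 1) / 2\<close>, and the indices \<open>r\<close> and \<open>- r\<close> yield
  the two families of summands.\<close>

lemma partition_count_alternating_sum:
  fixes s n :: nat and w a :: "int \<Rightarrow> nat"
  assumes "n > 0" and k: "k = 2 * s + 1"
    and w: "\<And>r. w r = 2 * triangle r + triangle (- r)"
    and a: "\<And>r. a r = nat (int k * (3 * int s + 1 - 3 * r))"
  shows "(\<Sum>r=-int s..int s. (- 1) ^ nat \<bar>r\<bar> *
    int (partition_count (3 * (int k)\<^sup>2) (int (a r)) (int n - int (w r)))) = 0"
proof -
  define b where "b = 3 * k\<^sup>2"
  \<comment> \<open>The complement of \<open>a r\<close> in the modulus:
    \<open>a r + c r = 3 * k^2\<close>.\<close>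
  define c where "c r = nat (int k * (3 * int s + 2 + 3 * r))" for r
  \<comment> \<open>With these \<open>u\<close> and \<open>v\<close> the theta sum is the pentagonal
    number series, since \<open>2 * triangle r + triangle (- r)\<close> is the exponent of
    \<open>fps_X\<close>.\<close>
  define u where "u = - (fps_X ^ 2 :: int fps)"
  define v where "v = - (fps_X ^ 1 :: int fps)"
  \<comment> \<open>The bound \<open>b * n\<close> comprises \<open>n\<close> full periods, as
    \<open>excluded_product_cong\<close> demands, and is at least \<open>n\<close>.\<close>
  define S where "S r = {x\<in>{1..b * n}. \<not> excluded (int b) (int (a r)) x}" for r
  define F where "F = (\<Sum>r=-int s..int s. theta_term u v r * partition_gf (S r))"
  let ?I = "{-int s..int s}" and ?T = "{1..b * n}"
  have ac: "0 < a r" "0 < c r" "a r \<noteq> c r" "b = a r + c r" if "r \<in> ?I" for r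
  proof -
    show pos: "0 < a r" "0 < c r"
      using that k unfolding a c_def by (auto simp: zero_less_mult_iff)
    have ia: "int (a r) = int k * (3 * int s + 1 - 3 * r)" and ic: "int (c r) = int k * (3 * int s + 2 + 3 * r)"
      using pos unfolding a c_def by auto
    \<comment> \<open>After cancelling \<open>k\<close> the two sides are 1 and 2 modulo 3.\<close>
    have "int (a r) \<noteq> int (c r)"
      unfolding ia ic using k by simp presburger
    then show "a r \<noteq> c r"
      by simp
    have "int b = int (a r) + int (c r)"
      unfolding of_nat_add ia ic b_def by (simp add: k power2_eq_square algebra_simps)
    then show "b = a r + c r"
      by simp
  qed
  have tt: "theta_term u v r = (- 1) ^ nat \<bar>r\<bar> * fps_X ^ w r" for r
  proof -
    \<comment> \<open>The total exponent is \<open>r * r\<close>, which has the parity of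
      \<open>r\<close>.\<close>
    have "even (triangle r + triangle (- r)) = even (2 * int (triangle r + triangle (- r)) div 2)"
      by simp
    also have "2 * int (triangle r + triangle (- r)) = 2 * (r * r)"
      unfolding of_nat_add distrib_left two_triangle by (simp add: algebra_simps)
    finally have "even (triangle r + triangle (- r)) = even (nat \<bar>r\<bar>)"
      by (simp add: even_nat_iff)
    then have "(- 1) ^ triangle r * (- 1) ^ triangle (- r) = ((- 1) ^ nat \<bar>r\<bar> :: int fps)"
      unfolding power_add[symmetric] by (simp only: minus_one_power_iff)
    moreover have "theta_term u v r =
        ((- 1) ^ triangle r * (- 1) ^ triangle (- r)) * (fps_X ^ (2 * triangle r) * fps_X ^ triangle (- r))"
      unfolding theta_term_def u_def v_def
      by (subst (1 2) power_minus) (simp add: mult_ac flip: power_mult)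
    ultimately show ?thesis
      by (simp add: w power_add)
  qed
  have uv: "u ^ x * v ^ y = - (fps_X ^ z)" if "odd (x + y)" "z = 2 * x + y" for x y z
  proof -
    have "u ^ x * v ^ y = (- 1) ^ (x + y) * (fps_X ^ (2 * x) * fps_X ^ y)"
      unfolding u_def v_def power_add
      by (subst (1 2) power_minus) (simp add: mult_ac flip: power_mult)
    also have "\<dots> = - (fps_X ^ z)"
      using that(1) unfolding that(2) power_add[symmetric] by (simp only: minus_one_power_iff) simp
    finally show ?thesis .
  qed
  have euler: "fps_X ^ Suc n dvd euler_factors ?T - theta_sum (k * n + s) u v"
  proof -
    \<comment> \<open>Every number is 0, 1 or -1 modulo 3, so the case of modulus 3 is the full
      Euler product, and the triple product specializes to Euler's pentagonal number
      theorem.\<close>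
    have "excluded 3 1 x" for x
    proof -
      have "int x mod 3 = 0 \<or> int x mod 3 = 1 \<or> int x mod 3 = 2"
        by linarith
      then show ?thesis
        by (auto simp: excluded_def cong_def)
    qed
    then have eq: "{x\<in>{1..3 * (k\<^sup>2 * n)}. excluded (int 3) (int 1) x} = ?T"
      by (auto simp: b_def)
    have "fps_X ^ Suc (k\<^sup>2 * n) dvd euler_factors ?T - theta_sum (k\<^sup>2 * n) u v"
      using excluded_product_cong[of 1 2 3 "k\<^sup>2 * n"] unfolding eq u_def v_def by simp
    moreover have kn: "k * n + s \<le> k\<^sup>2 * n"
    proof -
      have "s * 1 \<le> (k * (2 * s)) * n"
        using k \<open>n > 0\<close> by (intro mult_le_mono) auto
      moreover have "k\<^sup>2 * n = k * n + (k * (2 * s)) * n"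
        by (simp add: k power2_eq_square algebra_simps)
      ultimately show ?thesis by simp
    qed
    moreover have "n \<le> k * n + s"
      by (simp add: k)
    \<comment> \<open>The theta sum is shortened to the length \<open>k * n + s\<close> that the
      dissection into sums of length \<open>n\<close> requires.\<close>
    moreover have "fps_X ^ Suc (k * n + s) dvd theta_sum (k\<^sup>2 * n) u v - theta_sum (k * n + s) u v"
      using kn by (intro theta_sum_cong) (simp_all add: u_def v_def)
    ultimately show ?thesis
      by (meson dvd_diff_trans dvd_trans le_imp_power_dvd le_trans Suc_le_mono)
  qed
  have split: "theta_sum (k * n + s) u v = (\<Sum>r\<in>?I. theta_term u v r *
      theta_sum n (- (fps_X ^ c r)) (- (fps_X ^ a r)))"
    unfolding theta_sum_dissection[OF k]
  proof (intro sum.cong refl arg_cong2[where f = "(*)"] arg_cong2[where f = "theta_sum n"] uv)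
    fix r assume r: "r \<in> ?I"
    have nn: "0 \<le> int k * (int s + 1 + r)" "0 \<le> int k * (int s + r)"
      "0 \<le> int k * (int s - r)" "0 \<le> int k * (int s + 1 - r)"
      "0 \<le> int k * (3 * int s + 2 + 3 * r)" "0 \<le> int k * (3 * int s + 1 - 3 * r)"
      using r by auto
    \<comment> \<open>Both exponent sums are products of odd numbers, so the signs in
      \<open>u\<close> and \<open>v\<close> leave a minus sign in each new argument.\<close>
    have "int k * (int s + 1 + r) + int k * (int s + r) = int k * (2 * (int s + r) + 1)"
      "int k * (int s - r) + int k * (int s + 1 - r) = int k * (2 * (int s - r) + 1)"
      by (simp_all add: algebra_simps)
    then have "odd (int k * (int s + 1 + r) + int k * (int s + r))"
      "odd (int k * (int s - r) + int k * (int s + 1 - r))"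
      by (simp_all add: k)
    then show "odd (nat (int k * (int s + 1 + r)) + nat (int k * (int s + r)))"
      "odd (nat (int k * (int s - r)) + nat (int k * (int s + 1 - r)))"
      using nn by (simp_all add: even_nat_iff flip: nat_add_distrib)
    have "int (c r) = int (2 * nat (int k * (int s + 1 + r)) + nat (int k * (int s + r)))"
      "int (a r) = int (2 * nat (int k * (int s - r)) + nat (int k * (int s + 1 - r)))"
      using nn unfolding a c_def by (simp_all add: algebra_simps)
    then show "c r = 2 * nat (int k * (int s + 1 + r)) + nat (int k * (int s + r))"
      "a r = 2 * nat (int k * (int s - r)) + nat (int k * (int s + 1 - r))"
      by linarith+
  qed
  \<comment> \<open>Multiplication by the full Euler product turns each generating function into the
    product over its excluded parts, hence into the theta sum of its residue class in the
    dissection.\<close>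
  have "fps_X ^ Suc n dvd euler_factors ?T * F - theta_sum (k * n + s) u v"
  proof -
    have "euler_factors ?T * F = (\<Sum>r\<in>?I. theta_term u v r *
        euler_factors {x\<in>?T. excluded (int b) (int (a r)) x})"
      unfolding F_def sum_distrib_left
    proof (intro sum.cong refl)
      fix r
      have "partition_gf (S r) * euler_factors ?T = euler_factors (?T - S r)"
        by (rule partition_gf_mult_euler_factors_superset) (auto simp: S_def)
      also have "?T - S r = {x\<in>?T. excluded (int b) (int (a r)) x}"
        by (auto simp: S_def)
      finally have gf: "partition_gf (S r) * euler_factors ?T =
          euler_factors {x\<in>?T. excluded (int b) (int (a r)) x}" .
      have "euler_factors ?T * (theta_term u v r * partition_gf (S r)) =
          theta_term u v r * (partition_gf (S r) * euler_factors ?T)"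
        by (simp only: mult_ac)
      then show "euler_factors ?T * (theta_term u v r * partition_gf (S r)) =
          theta_term u v r * euler_factors {x\<in>?T. excluded (int b) (int (a r)) x}"
        unfolding gf .
    qed
    then have "euler_factors ?T * F - theta_sum (k * n + s) u v =
        (\<Sum>r\<in>?I. theta_term u v r * (euler_factors {x\<in>?T. excluded (int b) (int (a r)) x} -
          theta_sum n (- (fps_X ^ c r)) (- (fps_X ^ a r))))"
      unfolding split by (simp only: sum_subtractf right_diff_distrib)
    also have "fps_X ^ Suc n dvd \<dots>"
      using ac by (intro dvd_sum dvd_mult excluded_product_cong)
    finally show ?thesis .
  qed
  \<comment> \<open>Both congruences have the same theta sum, so \<open>F\<close> times the Euler
    product is congruent to that product; its inverse \<open>partition_gf ?T\<close> gives
    \<open>F\<close> congruent to 1, whose coefficient at \<open>n > 0\<close> is 0.\<close>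
  from dvd_diff[OF this euler] have "fps_X ^ Suc n dvd euler_factors ?T * F - euler_factors ?T"
    by simp
  then have "fps_X ^ Suc n dvd partition_gf ?T * (euler_factors ?T * F - euler_factors ?T)"
    by (rule dvd_mult)
  also have "\<dots> = (partition_gf ?T * euler_factors ?T) * (F - 1)"
    by (simp only: right_diff_distrib mult_1_right mult.assoc)
  also have "\<dots> = F - 1"
    by (subst partition_gf_mult_euler_factors) simp_all
  finally have "F $ n = 1 $ n"
    by (rule fps_nth_eq_of_dvd_diff) simp
  moreover have "F $ n = (\<Sum>r\<in>?I. (- 1) ^ nat \<bar>r\<bar> *
      int (partition_count (int b) (int (a r)) (int n - int (w r))))"
    unfolding F_def fps_sum_nth
  proof (intro sum.cong refl)
    fix r
    have "n \<le> b * n"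
      by (simp add: b_def k)
    then have "(fps_X ^ w r * partition_gf (S r)) $ n =
        int (partition_count (int b) (int (a r)) (int n - int (w r)))"
      unfolding S_def by (rule fps_X_power_mult_partition_gf_nth)
    then show "(theta_term u v r * partition_gf (S r)) $ n = (- 1) ^ nat \<bar>r\<bar> *
        int (partition_count (int b) (int (a r)) (int n - int (w r)))"
      by (simp add: tt minus_one_power_iff)
  qed
  ultimately show ?thesis
    using \<open>n > 0\<close> by (simp add: b_def)
qed

theorem theorem1p4:
  fixes t n :: nat
  assumes "t \<ge> 2" and "n > 0"
  shows "int (partition_count (b_mod t) (a_minus t 0) (int n)) =
    (\<Sum>r = 1..t - 1. (- 1) ^ (r + 1) *
      (int (partition_count (b_mod t) (a_plus t r) (int n - omega_minus r)) +
       int (partition_count (b_mod t) (a_minus t r) (int n - omega_plus r))))"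
proof -
  define s where "s = t - 1"
  define k where "k = 2 * s + 1"
  define w where "w r = 2 * triangle r + triangle (- r)" for r
  define a where "a r = nat (int k * (3 * int s + 1 - 3 * r))" for r
  define f where "f r = (- 1) ^ nat \<bar>r\<bar> *
    int (partition_count (3 * (int k)\<^sup>2) (int (a r)) (int n - int (w r)))" for r
  have t: "int t = int s + 1"
    using assms by (auto simp: s_def)
  have b: "b_mod t = 3 * (int k)\<^sup>2"
    by (simp add: b_mod_def k_def t)
  have f_pos: "f (int r) = (- 1) ^ r *
      int (partition_count (b_mod t) (a_minus t r) (int n - omega_plus r))" if "r \<le> s" for r
  proof -
    have "2 * int (w (int r)) = 2 * omega_plus r"
      unfolding w_def two_omega_plus of_nat_add of_nat_mult distrib_left mult.left_commute[of 2] two_triangle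
      by (simp add: power2_eq_square algebra_simps two_triangle)
    moreover have "int (a (int r)) = a_minus t r"
      using that by (simp add: a_def a_minus_def t k_def)
    ultimately show ?thesis
      by (simp add: f_def b)
  qed
  have f_neg: "f (- int r) = (- 1) ^ r *
      int (partition_count (b_mod t) (a_plus t r) (int n - omega_minus r))" if "r \<le> s" for r
  proof -
    have "2 * int (w (- int r)) = 2 * omega_minus r"
      unfolding w_def two_omega_minus of_nat_add of_nat_mult distrib_left mult.left_commute[of 2] two_triangle
      by (simp add: power2_eq_square algebra_simps two_triangle)
    \<comment> \<open>Negative indices produce the residue \<open>b_mod t - a_plus t r\<close>,
      which forbids the same parts as \<open>a_plus t r\<close>.\<close>
    moreover have "int (a (- int r)) = b_mod t - a_plus t r"
      using that by (simp add: a_def a_plus_def b t k_def power2_eq_square algebra_simps)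
    ultimately show ?thesis
      using partition_count_mod_minus by (simp add: f_def b)
  qed
  have "0 = (\<Sum>r=-int s..int s. f r)"
    unfolding f_def using assms(2)
    by (subst partition_count_alternating_sum[where s = s and w = w and a = a])
      (simp_all add: k_def w_def a_def)
  also have "\<dots> = f 0 + (\<Sum>r=1..s. f (- int r) + f (int r))"
    by (rule sum_symmetric_interval)
  \<comment> \<open>Moving these terms across the equation turns the sign \<open>(- 1) ^ r\<close>
    into \<open>(- 1) ^ (r + 1)\<close>.\<close>
  also have "(\<Sum>r=1..s. f (- int r) + f (int r)) = - (\<Sum>r = 1..s. (- 1) ^ (r + 1) *
      (int (partition_count (b_mod t) (a_plus t r) (int n - omega_minus r)) +
       int (partition_count (b_mod t) (a_minus t r) (int n - omega_plus r))))"
    by (simp add: f_pos f_neg distrib_left add.commute flip: sum_negf)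
  also have "f 0 = int (partition_count (b_mod t) (a_minus t 0) (int n))"
    using f_pos[of 0] by (simp add: omega_plus_def)
  finally show ?thesis
    by (simp add: s_def)
qed

end
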